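(* Let $k\ge 3$, let $G$ be a (binary) semigroup, and let $M=M^{g}(k-1)$ be the $k$-ary matrix over $G$ with entries $g^{(1)},\ldots,g^{(k-1)}\in G$, i.e. the $(k-1)\times(k-1)$ cyclic-shift matrix with $(j,j+1)$ entry $g^{(j)}$ for $1\le j\le k-2$, $(k-1,1)$ entry $g^{(k-1)}$, and all other entries $0$. If $M$ is idempotent, i.e. $\mu_k[M,\ldots,M]=M^k=M$, then its elements satisfy the $k-1$ relations $$g^{(1)}g^{(2)}\cdots g^{(k-2)}g^{(k-1)}g^{(1)}=g^{(1)},$$ $$g^{(2)}g^{(3)}\cdots g^{(k-1)}g^{(1)}g^{(2)}=g^{(2)},$$ $$\vdots$$ $$g^{(k-1)}g^{(1)}g^{(2)}\cdots g^{(k-2)}g^{(k-1)}=g^{(k-1)}.$$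
   Context: The symbol $0$ in the matrices is a formal zero. The set of all such $k$-ary matrices is closed under the $k$-ary multiplication $\mu_k[M_1,\ldots,M_k]=M_1M_2\cdots M_k$ (ordinary product of $k$ matrices), and forms a $k$-ary semigroup $\mathcal{M}_k^g$. An element $M$ of a $k$-ary semigroup is idempotent if its first polyadic power $M^{\langle 1\rangle_k}=\mu_k[M,\ldots,M]$ ($k$ factors) equals $M$. *)

theory Defs
  imports "HOL-Library.Multiset" "Jordan_Normal_Form.Matrix"
begin

text \<open>
  To multiply matrices whose entries lie in \<open>G \<union> {0}\<close>, with \<open>0\<close> a formal zero, we place the
  entries in the semigroup semiring \<open>\<nat>[G]\<close> of formal finite sums of elements of \<open>G\<close>. Formal sums
  are multisets: the formal zero is the empty multiset, \<open>g \<in> G\<close> is the singleton \<open>{#g#}\<close>, and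
  addition is multiset union. With the bilinear extension of the multiplication of \<open>G\<close> this
  is a \<open>semiring_0\<close>, so that the library's matrix product applies. On \<open>G \<union> {0}\<close> it gives
  \<open>0 + x = x + 0 = x\<close>, \<open>0 x = x 0 = 0\<close> and the given product of \<open>G\<close>.
\<close>

instantiation multiset :: (times) times
begin

definition times_multiset :: "'a multiset \<Rightarrow> 'a multiset \<Rightarrow> 'a multiset" where
  "A * B = (\<Sum>a\<in>#A. image_mset (\<lambda>b. a * b) B)"

instance ..

end

lemma formal_sum_mult_single: "{#a#} * {#b#} = {#a * b#}"
  by (simp add: times_multiset_def)

instance multiset :: (semigroup_mult) semiring_0
proof
  fix A B C :: "'a multiset"
  show dr: "(A + B) * C = A * C + B * C" for A B C :: "'a multiset"
    by (simp add: times_multiset_def)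
  show "A * (B + C) = A * B + A * C"
    by (simp add: times_multiset_def sum_mset.distrib)
  show z: "{#} * A = {#}" for A :: "'a multiset"
    by (simp add: times_multiset_def)
  show "A * {#} = {#}"
    by (simp add: times_multiset_def)
  have single: "{#a#} * B * C = {#a#} * (B * C)" for a
  proof (induction B)
    case empty
    then show ?case by (simp add: times_multiset_def)
  next
    case (add b B)
    have "{#a#} * add_mset b B * C = {#a * b#} * C + {#a#} * B * C"
      by (simp add: times_multiset_def)
    also have "{#a * b#} * C = {#a#} * ({#b#} * C)"
      by (auto simp: times_multiset_def multiset.map_comp mult.assoc intro!: image_mset_cong)
    finally show ?case
      by (simp add: add.IH) (simp add: times_multiset_def)
  qed
  show "A * B * C = A * (B * C)"
  proof (induction A)
    case empty
    then show ?case by (simp add: z)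
  next
    case (add a A)
    then show ?case
      by (simp only: add_mset_add_single[of a A] dr single)
  qed
qed

text \<open>
  The product \<open>x\<^sub>1 x\<^sub>2 \<cdots> x\<^sub>n\<close> of a nonempty list. Semigroups have no unit, so \<open>prod_list\<close> is not
  available.
\<close>

definition nonempty_prod :: "'a::times list \<Rightarrow> 'a" where
  "nonempty_prod xs = foldl (*) (hd xs) (tl xs)"

text \<open>
  The matrix \<open>M\<^sup>g(k-1)\<close>. Library matrices are indexed from 0, whereas the elements \<open>g\<close> are
  numbered from 1: position \<open>(i, j)\<close> below is the mathematical position \<open>(i + 1, j + 1)\<close>.
\<close>

definition kary_matrix :: "nat \<Rightarrow> (nat \<Rightarrow> 'g) \<Rightarrow> 'g multiset mat" where
  "kary_matrix k g = mat (k - 1) (k - 1) (\<lambda>(i, j).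
     if j = i + 1 then {#g (i + 1)#}
     else if i + 1 = k - 1 \<and> j = 0 then {#g (k - 1)#}
     else {#})"

text \<open>
  A \<open>k\<close>-ary operation is a function on lists, of which only the values on lists of length \<open>k\<close>
  matter.
\<close>

definition mu :: "'g::semigroup_mult multiset mat list \<Rightarrow> 'g multiset mat" where
  "mu Ms = nonempty_prod Ms"

definition first_polyadic_power :: "nat \<Rightarrow> ('a list \<Rightarrow> 'a) \<Rightarrow> 'a \<Rightarrow> 'a" where
  "first_polyadic_power k m x = m (replicate k x)"

definition polyadic_idempotent :: "nat \<Rightarrow> ('a list \<Rightarrow> 'a) \<Rightarrow> 'a \<Rightarrow> bool" where
  "polyadic_idempotent k m x \<longleftrightarrow> first_polyadic_power k m x = x"

end

theory Submission
  imports Defs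
begin

text \<open>
  Put \<open>n = k - 1\<close> and number rows, columns and entries cyclically modulo \<open>n\<close>. The matrix is then
  a weighted adjacency matrix of the directed \<open>n\<close>-cycle: row \<open>i\<close> has a single nonzero entry, in
  column \<open>i + 1\<close>. From each vertex there is exactly one walk of a given length, so every power is
  again monomial: the only nonzero entry in row \<open>i\<close> of the \<open>m\<close>-th power lies in column \<open>i + m\<close>
  and is the product of the \<open>m\<close> consecutive weights met on the walk
  (\<open>kary_matrix_power_index\<close>). No sum with two nonzero terms ever occurs, so each nonzero entry is
  a single element of the semigroup rather than a proper formal sum. A walk of length \<open>k = n + 1\<close>
  goes once around the cycle and then repeats its first step. Hence the \<open>k\<close>-th power has the same
  zero pattern as the matrix itself, and comparing its nonzero entries with those of the matrix
  gives one relation for each of the \<open>n\<close> rows.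
\<close>

lemma nonempty_prod_snoc:
  "xs \<noteq> [] \<Longrightarrow> nonempty_prod (xs @ [x]) = nonempty_prod xs * x"
  by (cases xs) (simp_all add: nonempty_prod_def)

lemma kary_matrix_carrier: "kary_matrix k g \<in> carrier_mat (k - 1) (k - 1)"
  by (simp add: kary_matrix_def)

text \<open>
  The two kinds of nonzero entries, above the diagonal and in the corner, become one once columns
  are read modulo \<open>k - 1\<close>.
\<close>

lemma kary_matrix_index:
  assumes "i < k - 1" "j < k - 1"
  shows "kary_matrix k g $$ (i, j) = (if j = (i + 1) mod (k - 1) then {#g (i + 1)#} else {#})"
proof (cases "i + 1 = k - 1")
  case True
  then show ?thesis using assms by (auto simp: kary_matrix_def)
next
  case False
  then show ?thesis using assms by (auto simp: kary_matrix_def)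
qed

lemma kary_matrix_power_carrier:
  "nonempty_prod (replicate (Suc m) (kary_matrix k g)) \<in> carrier_mat (k - 1) (k - 1)"
proof (induction m)
  case 0
  then show ?case using kary_matrix_carrier[of k g] by (simp add: nonempty_prod_def)
next
  case (Suc m)
  have "nonempty_prod (replicate (Suc (Suc m)) (kary_matrix k g))
      = nonempty_prod (replicate (Suc m) (kary_matrix k g)) * kary_matrix k g"
    by (subst replicate_Suc, subst replicate_append_same[symmetric], rule nonempty_prod_snoc) simp
  then show ?case
    using mult_carrier_mat[OF Suc.IH kary_matrix_carrier] by simp
qed

text \<open>
  In the induction step the sum over the intermediate vertex collapses to the vertex reached by
  the walk so far, which contributes the next weight. The weights are written as a cyclic sequence,
  so that the walk starting at \<open>i\<close> meets those at the positions \<open>i, i + 1, \<dots>\<close> without case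
  distinction.
\<close>

lemma kary_matrix_power_index:
  assumes "i < k - 1" "j < k - 1"
  shows "nonempty_prod (replicate (Suc m) (kary_matrix k g)) $$ (i, j) =
    (if j = (i + Suc m) mod (k - 1)
     then {#nonempty_prod (map (\<lambda>t. g (t mod (k - 1) + 1)) [i..<i + Suc m])#} else {#})"
  using assms(2)
proof (induction m arbitrary: j)
  case 0
  then show ?case
    using assms(1) by (simp add: kary_matrix_index nonempty_prod_def)
next
  case (Suc m)
  let ?n = "k - 1" and ?M = "kary_matrix k g"
  let ?P = "nonempty_prod (replicate (Suc m) ?M)"
  let ?p = "\<lambda>m. nonempty_prod (map (\<lambda>t. g (t mod ?n + 1)) [i..<i + m])"
  let ?l = "(i + Suc m) mod ?n"
  have l: "?l < ?n" using assms(1) by simp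
  have P: "nonempty_prod (replicate (Suc (Suc m)) ?M) = ?P * ?M"
    by (subst replicate_Suc, subst replicate_append_same[symmetric], rule nonempty_prod_snoc) simp
  have next_column: "(?l + 1) mod ?n = (i + Suc (Suc m)) mod ?n"
    by (simp add: mod_Suc_eq)
  have next_weight: "?p (Suc m) * g (?l + 1) = ?p (Suc (Suc m))"
    using nonempty_prod_snoc[of "map (\<lambda>t. g (t mod ?n + 1)) [i..<i + Suc m]" "g (?l + 1)"]
    by simp
  have "(?P * ?M) $$ (i, j) = (\<Sum>l = 0..<?n. ?P $$ (i, l) * ?M $$ (l, j))"
    using kary_matrix_power_carrier[of m k g] kary_matrix_carrier[of k g] assms(1) Suc.prems
    by (simp add: scalar_prod_def del: replicate_Suc)
  also have "\<dots> = (\<Sum>l = 0..<?n. if l = ?l then {#?p (Suc m)#} * ?M $$ (l, j) else {#})"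
    by (intro sum.cong) (simp_all add: Suc.IH del: replicate_Suc upt_Suc)
  also have "\<dots> = {#?p (Suc m)#} * ?M $$ (?l, j)"
    using l by (simp add: sum.delta del: upt_Suc)
  also have "\<dots> = (if j = (i + Suc (Suc m)) mod ?n then {#?p (Suc (Suc m))#} else {#})"
    by (simp only: kary_matrix_index[OF l Suc.prems] next_column formal_sum_mult_single next_weight
        mult_zero_right if_distrib[of "\<lambda>x. _ * x"])
  finally show ?case by (simp only: P)
qed

theorem proposition4p5:
  fixes g :: "nat \<Rightarrow> 'g::semigroup_mult" and k :: nat
  assumes "k \<ge> 3"
    and "polyadic_idempotent k mu (kary_matrix k g)"
  shows "\<forall>i\<in>{1..k - 1}. nonempty_prod (map g ([i..<k] @ [1..<i + 1])) = g i"
proof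
  fix i assume i: "i \<in> {1..k - 1}"
  let ?n = "k - 1"
  let ?i = "i - 1" and ?j = "i mod ?n"
  have bounds: "?i < ?n" "?j < ?n" using i assms(1) by auto
  have suc: "Suc ?n = k" "?i + 1 = i" using i assms(1) by auto
  have wrap: "(?i + Suc ?n) mod ?n = ?j"
  proof -
    have "?i + Suc ?n = i + ?n" using i by auto
    then show ?thesis by simp
  qed
  have once_around: "map (\<lambda>t. g (t mod ?n + 1)) [?i..<?i + Suc ?n] = map g ([i..<k] @ [1..<i + 1])"
  proof (rule nth_equalityI)
    show "length (map (\<lambda>t. g (t mod ?n + 1)) [?i..<?i + Suc ?n])
        = length (map g ([i..<k] @ [1..<i + 1]))"
      using i assms(1) by auto
  next
    fix t assume "t < length (map (\<lambda>t. g (t mod ?n + 1)) [?i..<?i + Suc ?n])"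
    then have t: "t < Suc ?n" by simp
    then have nth: "map (\<lambda>t. g (t mod ?n + 1)) [?i..<?i + Suc ?n] ! t = g ((?i + t) mod ?n + 1)"
      by (simp del: upt_Suc add_Suc_right)
    show "map (\<lambda>t. g (t mod ?n + 1)) [?i..<?i + Suc ?n] ! t
        = map g ([i..<k] @ [1..<i + 1]) ! t"
    proof (cases "t < k - i")
      case True
      then have "(?i + t) mod ?n + 1 = i + t" using i by auto
      then show ?thesis unfolding nth using True t by (simp add: nth_append del: upt_Suc)
    next
      case False
      \<comment> \<open>Position \<open>t = k - i\<close> is the first one after the return to row 0.\<close>
      then have "?i + t = (t - (k - i)) + ?n" using i by auto
      moreover have "t - (k - i) < ?n" using False i t assms(1) by auto
      ultimately have "(?i + t) mod ?n = t - (k - i)" by (simp only: mod_add_self2 mod_less)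
      moreover have "t - (k - i) < i" using False i t by auto
      ultimately show ?thesis unfolding nth using False t by (simp add: nth_append del: upt_Suc)
    qed
  qed
  have "nonempty_prod (replicate (Suc ?n) (kary_matrix k g)) = kary_matrix k g"
    using assms(2)
    by (simp only: suc polyadic_idempotent_def first_polyadic_power_def mu_def)
  then have "nonempty_prod (replicate (Suc ?n) (kary_matrix k g)) $$ (?i, ?j)
      = kary_matrix k g $$ (?i, ?j)"
    by (rule arg_cong)
  then have "{#nonempty_prod (map g ([i..<k] @ [1..<i + 1]))#} = {#g i#}"
    unfolding kary_matrix_power_index[OF bounds] kary_matrix_index[OF bounds] wrap once_around
    by (simp only: suc if_True simp_thms)
  then show "nonempty_prod (map g ([i..<k] @ [1..<i + 1])) = g i"
    by (simp only: single_eq_single)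
qed

end
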